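(* Let $\mathscr G_0,\mathscr G_1$ be uncertainty classes of probability distributions on $\Omega$, and for $u\in[0,1]$ let $D_u(G_0,G_1)=\int_\Omega g_1^{\,u}g_0^{\,1-u}\,d\mu$. Suppose that: (i) $D_u$ is real valued, upper semi-continuous and quasi-concave on $\mathscr G_0\times\mathscr G_1$ for all $u\in[0,1]$; (ii) $D_u$ is lower semi-continuous and quasi-convex in $u$ on $[0,1]$ for all $(G_0,G_1)\in\mathscr G_0\times\mathscr G_1$; (iii) $[0,1]$ is a compact convex subset of a linear topological space; (iv) $\mathscr G_0\times\mathscr G_1$ is a convex subset of a linear topological space. Then a solution to the saddle value problem exists, i.e. $$\min_{u\in(0,1)}\ \sup_{(G_0,G_1)\in\mathscr G_0\times\mathscr G_1}D_u(G_0,G_1)=\sup_{(G_0,G_1)\in\mathscr G_0\times\mathscr G_1}\ \min_{u\in(0,1)}D_u(G_0,G_1).$$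
   Context: $g_j$ denotes the density of $G_j\in\mathscr G_j$ with respect to a common dominating measure $\mu$ on $\Omega$, with $g_j>0$ and $\int_\Omega g_j\,d\mu=1$; in particular $D_0(G_0,G_1)=D_1(G_0,G_1)=1$. $D_u$ is called the $u$-affinity. *)

theory Defs
  imports "HOL-Probability.Probability"
begin

text \<open>
  Real linear topological spaces: both vector space operations are jointly continuous
  (continuity of negation follows, as \<open>- x = (-1) *\<^sub>R x\<close>). No separation axiom is required.
\<close>

class linear_topological_space = real_vector + topological_monoid_add +
  assumes tendsto_scaleR_Pair:
    "LIM x (nhds a \<times>\<^sub>F nhds b). fst x *\<^sub>R snd x :> nhds (a *\<^sub>R b)"

instance real_normed_vector < linear_topological_space
proof
  fix a :: real and b :: 'a
  show "LIM x (nhds a \<times>\<^sub>F nhds b). fst x *\<^sub>R snd x :> nhds (a *\<^sub>R b)"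
    by (intro tendsto_scaleR filterlim_fst filterlim_snd)
qed

definition lower_semicontinuous_on :: "'v::topological_space set \<Rightarrow> ('v \<Rightarrow> real) \<Rightarrow> bool" where
  "lower_semicontinuous_on S f \<longleftrightarrow>
     (\<forall>x\<in>S. \<forall>c<f x. \<forall>\<^sub>F y in at x within S. c < f y)"

definition upper_semicontinuous_on :: "'v::topological_space set \<Rightarrow> ('v \<Rightarrow> real) \<Rightarrow> bool" where
  "upper_semicontinuous_on S f \<longleftrightarrow>
     (\<forall>x\<in>S. \<forall>c>f x. \<forall>\<^sub>F y in at x within S. f y < c)"

text \<open>The next two definitions are meant for convex \<open>S\<close>.\<close>

definition quasi_convex_on :: "'v::real_vector set \<Rightarrow> ('v \<Rightarrow> real) \<Rightarrow> bool" where
  "quasi_convex_on S f \<longleftrightarrow>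
     (\<forall>x\<in>S. \<forall>y\<in>S. \<forall>t\<in>{0..1}. f ((1 - t) *\<^sub>R x + t *\<^sub>R y) \<le> max (f x) (f y))"

definition quasi_concave_on :: "'v::real_vector set \<Rightarrow> ('v \<Rightarrow> real) \<Rightarrow> bool" where
  "quasi_concave_on S f \<longleftrightarrow>
     (\<forall>x\<in>S. \<forall>y\<in>S. \<forall>t\<in>{0..1}. min (f x) (f y) \<le> f ((1 - t) *\<^sub>R x + t *\<^sub>R y))"

text \<open>
  \<open>dens G\<close> is the chosen (everywhere positive) version of the density of \<open>G\<close> with
  respect to the dominating measure \<open>M\<close>, whose space is the sample space.
\<close>

definition uncertainty_class ::
    "'a measure \<Rightarrow> ('a measure \<Rightarrow> 'a \<Rightarrow> real) \<Rightarrow> 'a measure set \<Rightarrow> bool" where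
  "uncertainty_class M dens \<G> \<longleftrightarrow>
     (\<forall>G\<in>\<G>. prob_space G \<and> dens G \<in> borel_measurable M \<and>
        G = density M (\<lambda>x. ennreal (dens G x)) \<and>
        (\<forall>x\<in>space M. 0 < dens G x) \<and> (LINT x|M. dens G x) = 1)"

text \<open>
  The \<open>u\<close>-affinity; it does not depend on the chosen versions \<open>g0\<close>, \<open>g1\<close> of the densities.
  Finiteness of the integral has to be stated separately as integrability.
\<close>

definition affinity_integrand ::
    "('a measure \<Rightarrow> 'a \<Rightarrow> real) \<Rightarrow> ('a measure \<Rightarrow> 'a \<Rightarrow> real) \<Rightarrow>
     real \<Rightarrow> 'a measure \<times> 'a measure \<Rightarrow> 'a \<Rightarrow> real" where
  "affinity_integrand g0 g1 u = (\<lambda>(G0, G1) x. g1 G1 x powr u * g0 G0 x powr (1 - u))"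

definition affinity ::
    "'a measure \<Rightarrow> ('a measure \<Rightarrow> 'a \<Rightarrow> real) \<Rightarrow> ('a measure \<Rightarrow> 'a \<Rightarrow> real) \<Rightarrow>
     real \<Rightarrow> 'a measure \<times> 'a measure \<Rightarrow> real" where
  "affinity M g0 g1 u p = (LINT x|M. affinity_integrand g0 g1 u p x)"

definition attains_min_on :: "'b set \<Rightarrow> ('b \<Rightarrow> 'c::order) \<Rightarrow> bool" where
  "attains_min_on S f \<longleftrightarrow> (\<exists>x\<in>S. \<forall>y\<in>S. f x \<le> f y)"

end

theory Submission
  imports Defs
begin

text \<open>
  Because \<open>u\<close> is one-dimensional, Sion's minimax theorem needs no finite-intersection argument:
  the sublevel sets \<open>{u. f u v \<le> c}\<close> are compact intervals, any two of them meet (otherwise the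
  segment joining the two points \<open>v\<close>, \<open>w\<close> would split into two disjoint nonempty relatively open
  sets), and hence the supremum of their left ends lies in all of them. Young's inequality gives
  \<open>D\<^sub>u \<le> 1 = D\<^sub>0 = D\<^sub>1\<close>, so a minimum over \<open>[0,1]\<close> at an endpoint forces the function to be
  constant, and the minimum is also attained in the open interval.
\<close>

section \<open>Semicontinuity and attained minima\<close>

lemma continuous_on_segment:
  fixes v w :: "'v::linear_topological_space"
  shows "continuous_on A (\<lambda>t::real. (1 - t) *\<^sub>R v + t *\<^sub>R w)"
proof -
  \<comment> \<open>With no norm at hand, the limit comes from joint continuity of scaling, with the
    vector held constant.\<close>
  have scale: "((\<lambda>s. h s *\<^sub>R x) \<longlongrightarrow> h t *\<^sub>R x) (at t within A)"
    if "(h \<longlongrightarrow> h t) (at t within A)" for h :: "real \<Rightarrow> real" and t and x :: 'v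
    using filterlim_compose[OF tendsto_scaleR_Pair filterlim_Pair[OF that tendsto_const]] by simp
  show ?thesis
    unfolding continuous_on_def
    by (intro ballI tendsto_add scale tendsto_intros)
qed

lemma closed_sublevel:
  fixes f :: "'v::topological_space \<Rightarrow> real"
  assumes "lower_semicontinuous_on S f" "closed S"
  shows "closed {x \<in> S. f x \<le> c}"
  unfolding closed_limpt
proof (intro allI impI)
  fix x assume x: "x islimpt {x \<in> S. f x \<le> c}"
  then have "x \<in> S"
    using \<open>closed S\<close> islimpt_subset[OF x, of S] unfolding closed_limpt by blast
  moreover have "\<not> c < f x"
  proof
    assume "c < f x"
    then have "\<forall>\<^sub>F y in at x within S. c < f y"
      using assms(1) \<open>x \<in> S\<close> unfolding lower_semicontinuous_on_def by blast
    then obtain U where "open U" "x \<in> U" and U: "\<And>y. y \<in> U \<Longrightarrow> y \<noteq> x \<Longrightarrow> y \<in> S \<Longrightarrow> c < f y"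
      unfolding eventually_at_topological by blast
    then obtain y where "y \<in> {x \<in> S. f x \<le> c}" "y \<in> U" "y \<noteq> x"
      using islimptE[OF x] by metis
    then show False using U[of y] by auto
  qed
  ultimately show "x \<in> {x \<in> S. f x \<le> c}" by auto
qed

text \<open>Without a minimum, every point has an open neighbourhood on which \<open>f\<close> stays
  above one of its own values \<open>f y\<close>. Among the finitely many \<open>y\<close> of a
  subcover, the one with the least value lies in some covering set and so exceeds another such
  value. The codomain is a general linear order because both real and \<open>ereal\<close> values
  occur.\<close>

lemma lsc_attains_min_on:
  fixes f :: "'v::topological_space \<Rightarrow> 'c::linorder"
  assumes "compact S" "S \<noteq> {}"
    and lsc: "\<And>x c. x \<in> S \<Longrightarrow> c < f x \<Longrightarrow> \<forall>\<^sub>F y in at x within S. c < f y"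
  shows "attains_min_on S f"
proof (rule ccontr)
  assume "\<not> attains_min_on S f"
  then have ex: "\<exists>y\<in>S. f y < f x" if "x \<in> S" for x
    using that unfolding attains_min_on_def by (meson not_le)
  define \<U> where "\<U> = {(U, y). open U \<and> y \<in> S \<and> (\<forall>z\<in>U \<inter> S. f y < f z)}"
  have "S \<subseteq> (\<Union>p\<in>\<U>. fst p)"
  proof
    fix x assume "x \<in> S"
    then obtain y where y: "y \<in> S" "f y < f x" using ex by blast
    obtain U where "open U" "x \<in> U" "\<And>z. z \<in> U \<Longrightarrow> z \<noteq> x \<Longrightarrow> z \<in> S \<Longrightarrow> f y < f z"
      using lsc[OF \<open>x \<in> S\<close> y(2)] unfolding eventually_at_topological by blast
    with y have "(U, y) \<in> \<U>" unfolding \<U>_def by auto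
    with \<open>x \<in> U\<close> show "x \<in> (\<Union>p\<in>\<U>. fst p)" by force
  qed
  then obtain \<F> where \<F>: "\<F> \<subseteq> \<U>" "finite \<F>" "S \<subseteq> (\<Union>p\<in>\<F>. fst p)"
    by (rule compactE_image[OF \<open>compact S\<close>, rotated]) (auto simp: \<U>_def)
  with \<open>S \<noteq> {}\<close> have "\<F> \<noteq> {}" by auto
  then obtain p where p: "p \<in> \<F>" "\<And>q. q \<in> \<F> \<Longrightarrow> f (snd p) \<le> f (snd q)"
    using arg_min_if_finite(1)[OF \<F>(2)] arg_min_least[OF \<F>(2), of _ "\<lambda>q. f (snd q)"] by blast
  have "snd p \<in> S" using p(1) \<F>(1) unfolding \<U>_def by auto
  with \<F>(3) obtain q where q: "q \<in> \<F>" "snd p \<in> fst q" by auto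
  with \<F>(1) \<open>snd p \<in> S\<close> have "f (snd q) < f (snd p)" unfolding \<U>_def by auto
  with p(2)[OF q(1)] show False by simp
qed

text \<open>An endpoint minimiser can be traded for any interior point, whose value is no
  larger.\<close>

lemma attains_min_on_interior:
  fixes f :: "real \<Rightarrow> 'c::order"
  assumes "attains_min_on {a..b} f" "a < b"
    and "\<And>u. u \<in> {a<..<b} \<Longrightarrow> f u \<le> f a" "\<And>u. u \<in> {a<..<b} \<Longrightarrow> f u \<le> f b"
  shows "attains_min_on {a<..<b} f"
proof -
  obtain x where x: "x \<in> {a..b}" "\<And>y. y \<in> {a..b} \<Longrightarrow> f x \<le> f y"
    using assms(1) unfolding attains_min_on_def by blast
  obtain m where m: "m \<in> {a<..<b}" using dense[OF \<open>a < b\<close>] by auto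
  consider "x \<in> {a<..<b}" | "x = a" | "x = b" using x(1) by fastforce
  then have "\<exists>z\<in>{a<..<b}. f z \<le> f x"
    by cases (use m assms(3,4)[OF m] in auto)
  then show ?thesis
    unfolding attains_min_on_def using x(2)
    by (meson greaterThanLessThan_subseteq_atLeastAtMost_iff order.refl order_trans subsetD)
qed

lemma lower_semicontinuous_on_SUP:
  fixes f :: "'v::topological_space \<Rightarrow> 'p \<Rightarrow> real"
  assumes "\<And>p. p \<in> P \<Longrightarrow> lower_semicontinuous_on S (\<lambda>x. f x p)"
    and "x \<in> S" "c < (SUP p\<in>P. ereal (f x p))"
  shows "\<forall>\<^sub>F y in at x within S. c < (SUP p\<in>P. ereal (f y p))"
proof -
  obtain p where p: "p \<in> P" "c < ereal (f x p)"
    using assms(3) unfolding less_SUP_iff by blast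
  \<comment> \<open>Semicontinuity of \<open>f\<close> needs a real bound, while \<open>c\<close> is
    an extended real; \<open>r\<close> also keeps the final inequality strict.\<close>
  obtain r where r: "c < ereal r" "r < f x p"
    using ereal_dense2[OF p(2)] by auto
  have "\<forall>\<^sub>F y in at x within S. r < f y p"
    using assms(1)[OF p(1)] assms(2) r(2) unfolding lower_semicontinuous_on_def by blast
  then show ?thesis
    by eventually_elim (use p(1) r(1) in \<open>auto simp: less_SUP_iff intro!: bexI[of _ p] less_trans[OF r(1)]\<close>)
qed

section \<open>Minimax inequality on a compact interval\<close>

text \<open>This is Helly's theorem on the line: two intervals that meet have each left end below
  the other's right end, so the supremum of all left ends lies between the ends of every
  interval.\<close>

lemma pairwise_intersecting_intervals:
  fixes A :: "'i \<Rightarrow> real set"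
  assumes "\<And>i. i \<in> I \<Longrightarrow> compact (A i)" "\<And>i. i \<in> I \<Longrightarrow> convex (A i)"
    and meet: "\<And>i j. i \<in> I \<Longrightarrow> j \<in> I \<Longrightarrow> A i \<inter> A j \<noteq> {}"
    and "I \<noteq> {}"
  shows "\<Inter>(A ` I) \<noteq> {}"
proof -
  have Inf_in: "Inf (A i) \<in> A i" if "i \<in> I" for i
    \<comment> \<open>Taking \<open>j = i\<close> in \<open>meet\<close> shows that
      \<open>A i\<close> is nonempty.\<close>
    using that assms(1) meet[of i i]
    by (intro closed_contains_Inf bounded_imp_bdd_below) (auto intro: compact_imp_closed compact_imp_bounded)
  have Sup_in: "Sup (A i) \<in> A i" if "i \<in> I" for i
    using that assms(1) meet[of i i]
    by (intro closed_contains_Sup bounded_imp_bdd_above) (auto intro: compact_imp_closed compact_imp_bounded)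
  have le: "Inf (A i) \<le> Sup (A j)" if ij: "i \<in> I" "j \<in> I" for i j
  proof -
    obtain x where "x \<in> A i" "x \<in> A j" using meet[OF ij] by auto
    moreover have "bdd_below (A i)" "bdd_above (A j)"
      by (intro bounded_imp_bdd_below bounded_imp_bdd_above compact_imp_bounded assms(1) ij)+
    ultimately show ?thesis by (meson cInf_lower cSup_upper order_trans)
  qed
  define s where "s = (SUP i\<in>I. Inf (A i))"
  have "s \<in> A i" if "i \<in> I" for i
  proof -
    have "Inf (A i) \<le> s"
      unfolding s_def using that le by (intro cSUP_upper bdd_aboveI2[of _ _ "Sup (A i)"]) auto
    moreover have "s \<le> Sup (A i)"
      unfolding s_def using that le \<open>I \<noteq> {}\<close> by (intro cSUP_least) auto
    ultimately show ?thesis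
      using Inf_in[OF that] Sup_in[OF that] assms(2)[OF that] is_interval_convex_1[of "A i"]
      unfolding is_interval_1 by blast
  qed
  then show ?thesis by auto
qed

lemma convex_sublevel:
  assumes "quasi_convex_on S f" "convex S"
  shows "convex {x \<in> S. f x \<le> c}"
  unfolding convex_alt
proof (intro ballI allI impI)
  fix x y and t :: real
  assume xy: "x \<in> {x \<in> S. f x \<le> c}" "y \<in> {x \<in> S. f x \<le> c}" and t: "0 \<le> t \<and> t \<le> 1"
  have "f ((1 - t) *\<^sub>R x + t *\<^sub>R y) \<le> max (f x) (f y)"
    using assms(1) xy t unfolding quasi_convex_on_def by auto
  moreover have "(1 - t) *\<^sub>R x + t *\<^sub>R y \<in> S"
    using assms(2) xy t unfolding convex_alt by blast
  ultimately show "(1 - t) *\<^sub>R x + t *\<^sub>R y \<in> {x \<in> S. f x \<le> c}"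
    using xy by auto
qed

text \<open>A \<open>u\<close> that witnesses the inequality at \<open>t\<close> still does so near
  \<open>t\<close>, by upper semicontinuity along the continuous segment.\<close>

lemma openin_inf_lt:
  fixes f :: "'i \<Rightarrow> 'v::linear_topological_space \<Rightarrow> real"
  assumes usc: "\<And>u. u \<in> U \<Longrightarrow> upper_semicontinuous_on K (f u)"
    and "convex K" "v \<in> K" "w \<in> K"
  shows "openin (top_of_set {0..1}) {t \<in> {0..1::real}. \<exists>u\<in>U. f u ((1 - t) *\<^sub>R v + t *\<^sub>R w) < c}"
    (is "openin _ ?T")
proof (subst openin_subopen, intro ballI)
  let ?z = "\<lambda>t. (1 - t) *\<^sub>R v + t *\<^sub>R w"
  have zK: "?z t \<in> K" if "t \<in> {0..1}" for t
    using assms(2-4) that unfolding convex_alt by auto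
  fix t assume "t \<in> ?T"
  then obtain u where u: "t \<in> {0..1}" "u \<in> U" "f u (?z t) < c" by auto
  have "\<forall>\<^sub>F y in at (?z t) within K. f u y < c"
    using usc[OF u(2)] zK[OF u(1)] u(3) unfolding upper_semicontinuous_on_def by blast
  then obtain N where N: "open N" "?z t \<in> N" "\<And>y. y \<in> N \<Longrightarrow> y \<noteq> ?z t \<Longrightarrow> y \<in> K \<Longrightarrow> f u y < c"
    unfolding eventually_at_topological by blast
  have "openin (top_of_set {0..1}) ({0..1} \<inter> ?z -` N)"
    using continuous_on_segment N(1) by (rule continuous_openin_preimage_gen)
  moreover have "{0..1} \<inter> ?z -` N \<subseteq> ?T"
  proof
    fix s assume s: "s \<in> {0..1} \<inter> ?z -` N"
    then have "f u (?z s) < c"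
      \<comment> \<open>The filter \<open>at\<close> omits the centre, so parameters
        \<open>s\<close> with the same image as \<open>t\<close> are treated apart.\<close>
      using N(3)[of "?z s"] zK[of s] u(3) by (cases "?z s = ?z t") auto
    with s u(2) show "s \<in> ?T" by auto
  qed
  ultimately show "\<exists>T. openin (top_of_set {0..1}) T \<and> t \<in> T \<and> T \<subseteq> ?T"
    using u(1) N(2) by blast
qed

text \<open>If the two sublevel sets were disjoint, quasi-concavity would put the sublevel set of
  each point of the segment inside their union, and connectedness inside just one of them. Which one
  it is would split \<open>{0..1}\<close> into two open pieces.\<close>

lemma sublevels_meet:
  fixes f :: "real \<Rightarrow> 'v::linear_topological_space \<Rightarrow> real"
  assumes usc: "\<And>u. u \<in> {a..b} \<Longrightarrow> upper_semicontinuous_on K (f u)"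
    and qconc: "\<And>u. u \<in> {a..b} \<Longrightarrow> quasi_concave_on K (f u)"
    and lsc: "\<And>v. v \<in> K \<Longrightarrow> lower_semicontinuous_on {a..b} (\<lambda>u. f u v)"
    and qconv: "\<And>v. v \<in> K \<Longrightarrow> quasi_convex_on {a..b} (\<lambda>u. f u v)"
    and "convex K"
    and lt: "\<And>v. v \<in> K \<Longrightarrow> \<exists>u\<in>{a..b}. f u v < c"
    and vw: "v \<in> K" "w \<in> K"
  shows "{u \<in> {a..b}. f u v \<le> c} \<inter> {u \<in> {a..b}. f u w \<le> c} \<noteq> {}"
proof
  define A where "A x = {u \<in> {a..b}. f u x \<le> c}" for x
  assume "{u \<in> {a..b}. f u v \<le> c} \<inter> {u \<in> {a..b}. f u w \<le> c} = {}"
  then have disj: "A v \<inter> A w = {}" by (simp add: A_def)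
  define z where "z t = (1 - t) *\<^sub>R v + t *\<^sub>R w" for t
  \<comment> \<open>The weak inequality in \<open>A\<close> yields closed sets, the strict one here
    open sets; \<open>lt\<close> supplies strict witnesses, so that the open sets still
    cover.\<close>
  define T where "T x = {t \<in> {0..1}. \<exists>u\<in>A x. f u (z t) < c}" for x
  have zK: "z t \<in> K" if "t \<in> {0..1}" for t
    using \<open>convex K\<close> vw that unfolding convex_alt z_def by auto
  have closed: "closed (A x)" if "x \<in> K" for x
    unfolding A_def using lsc[OF that] by (intro closed_sublevel) auto
  have connected: "connected (A x)" if "x \<in> K" for x
    unfolding A_def using qconv[OF that] by (intro convex_connected convex_sublevel) auto
  have sub: "A (z t) \<subseteq> A v \<union> A w" if "t \<in> {0..1}" for t
  proof
    fix u assume u: "u \<in> A (z t)"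
    then have "min (f u v) (f u w) \<le> f u (z t)"
      using qconc vw that unfolding A_def quasi_concave_on_def z_def by blast
    with u show "u \<in> A v \<union> A w" by (auto simp: A_def min_le_iff_disj)
  qed
  have "openin (top_of_set {0..1}) (T x)" for x
    unfolding T_def z_def using usc \<open>convex K\<close> vw by (intro openin_inf_lt) (auto simp: A_def)
  moreover have "{0..1} \<subseteq> T v \<union> T w"
  proof
    fix t :: real assume t: "t \<in> {0..1}"
    then obtain u where u: "u \<in> {a..b}" "f u (z t) < c" using lt zK by blast
    then have "u \<in> A v \<union> A w" using sub[OF t] by (auto simp: A_def)
    then show "t \<in> T v \<union> T w" using t u by (auto simp: T_def)
  qed
  moreover have "T v \<inter> T w = {}"
  proof (rule ccontr)
    assume "T v \<inter> T w \<noteq> {}"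
    then obtain t where "t \<in> T v" "t \<in> T w" by blast
    then have t: "t \<in> {0..1}" "A v \<inter> A (z t) \<noteq> {}" "A w \<inter> A (z t) \<noteq> {}"
      unfolding T_def A_def by (blast intro: less_imp_le)+
    \<comment> \<open>The connected set \<open>A (z t)\<close> would meet both of the disjoint
      closed sets \<open>A v\<close> and \<open>A w\<close> that cover it.\<close>
    show False
      using connected_closedD[OF connected[OF zK[OF t(1)]] _ sub[OF t(1)] closed closed] disj vw t(2,3)
      by blast
  qed
  moreover have "0 \<in> T v" "1 \<in> T w"
    using lt[OF vw(1)] lt[OF vw(2)] by (auto simp: T_def z_def A_def intro: less_imp_le)
  ultimately show False
    using connected_Icc[of 0 "1::real"] unfolding connected_openin by blast
qed

text \<open>This is the nontrivial minimax inequality at a fixed level: the last hypothesis holds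
  for every \<open>c\<close> above the sup-inf, and the conclusion bounds the inf-sup by
  \<open>c\<close>.\<close>

lemma minimax_level:
  fixes f :: "real \<Rightarrow> 'v::linear_topological_space \<Rightarrow> real"
  assumes "\<And>u. u \<in> {a..b} \<Longrightarrow> upper_semicontinuous_on K (f u)"
    and "\<And>u. u \<in> {a..b} \<Longrightarrow> quasi_concave_on K (f u)"
    and lsc: "\<And>v. v \<in> K \<Longrightarrow> lower_semicontinuous_on {a..b} (\<lambda>u. f u v)"
    and qconv: "\<And>v. v \<in> K \<Longrightarrow> quasi_convex_on {a..b} (\<lambda>u. f u v)"
    and "convex K" "K \<noteq> {}"
    and "\<And>v. v \<in> K \<Longrightarrow> \<exists>u\<in>{a..b}. f u v < c"
  shows "\<exists>u\<in>{a..b}. \<forall>v\<in>K. f u v \<le> c"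
proof -
  have "(\<Inter>v\<in>K. {u \<in> {a..b}. f u v \<le> c}) \<noteq> {}"
  proof (rule pairwise_intersecting_intervals)
    fix v assume v: "v \<in> K"
    have "closed {u \<in> {a..b}. f u v \<le> c}" using lsc[OF v] by (intro closed_sublevel) auto
    moreover have "bounded {u \<in> {a..b}. f u v \<le> c}"
      by (rule bounded_subset[OF bounded_closed_interval[of a b]]) auto
    ultimately show "compact {u \<in> {a..b}. f u v \<le> c}" by (simp add: compact_eq_bounded_closed)
    show "convex {u \<in> {a..b}. f u v \<le> c}" using qconv[OF v] by (intro convex_sublevel) auto
  next
    fix v w assume "v \<in> K" "w \<in> K"
    then show "{u \<in> {a..b}. f u v \<le> c} \<inter> {u \<in> {a..b}. f u w \<le> c} \<noteq> {}"
      using assms by (intro sublevels_meet) auto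
  qed fact
  then show ?thesis using \<open>K \<noteq> {}\<close> by blast
qed

section \<open>End values and upper bound of the affinity\<close>

lemma uncertainty_classD:
  assumes "uncertainty_class M g \<G>" "G \<in> \<G>"
  shows "integrable M (g G)" "(LINT x|M. g G x) = 1" "\<And>x. x \<in> space M \<Longrightarrow> 0 < g G x"
proof -
  show int_1: "(LINT x|M. g G x) = 1" and "\<And>x. x \<in> space M \<Longrightarrow> 0 < g G x"
    using assms unfolding uncertainty_class_def by blast+
  show "integrable M (g G)"
    \<comment> \<open>A non-integrable function has integral 0 by convention, which the value 1
      excludes.\<close>
    using not_integrable_integral_eq[of M "g G"] int_1 by linarith
qed

lemma affinity_0:
  assumes "uncertainty_class M g0 \<G>0" "uncertainty_class M g1 \<G>1" "p \<in> \<G>0 \<times> \<G>1"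
  shows "affinity M g0 g1 0 p = 1"
proof -
  obtain G0 G1 where p: "p = (G0, G1)" and G: "G0 \<in> \<G>0" "G1 \<in> \<G>1" using assms(3) by auto
  have "affinity M g0 g1 0 p = (LINT x|M. g0 G0 x)"
    unfolding affinity_def affinity_integrand_def p
    \<comment> \<open>Positivity matters, since \<open>0 powr 0\<close> is 0 by convention.\<close>
    using uncertainty_classD(3)[OF assms(1) G(1)] uncertainty_classD(3)[OF assms(2) G(2)]
    by (intro Bochner_Integration.integral_cong) (auto simp: less_imp_le less_imp_neq[symmetric])
  then show ?thesis using uncertainty_classD(2)[OF assms(1) G(1)] by simp
qed

lemma affinity_1:
  assumes "uncertainty_class M g0 \<G>0" "uncertainty_class M g1 \<G>1" "p \<in> \<G>0 \<times> \<G>1"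
  shows "affinity M g0 g1 1 p = 1"
proof -
  obtain G0 G1 where p: "p = (G0, G1)" and G: "G0 \<in> \<G>0" "G1 \<in> \<G>1" using assms(3) by auto
  have "affinity M g0 g1 1 p = (LINT x|M. g1 G1 x)"
    unfolding affinity_def affinity_integrand_def p
    using uncertainty_classD(3)[OF assms(1) G(1)] uncertainty_classD(3)[OF assms(2) G(2)]
    by (intro Bochner_Integration.integral_cong) (auto simp: less_imp_le less_imp_neq[symmetric])
  then show ?thesis using uncertainty_classD(2)[OF assms(2) G(2)] by simp
qed

text \<open>Young's inequality bounds the integrand pointwise by a convex combination of the two
  densities, whose integral is 1.\<close>

lemma affinity_le_1:
  assumes "uncertainty_class M g0 \<G>0" "uncertainty_class M g1 \<G>1" "p \<in> \<G>0 \<times> \<G>1"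
    and "u \<in> {0..1}" "integrable M (affinity_integrand g0 g1 u p)"
  shows "affinity M g0 g1 u p \<le> 1"
proof -
  obtain G0 G1 where p: "p = (G0, G1)" and G: "G0 \<in> \<G>0" "G1 \<in> \<G>1" using assms(3) by auto
  note G0 = uncertainty_classD[OF assms(1) G(1)] and G1 = uncertainty_classD[OF assms(2) G(2)]
  have "affinity M g0 g1 u p \<le> (LINT x|M. u * g1 G1 x + (1 - u) * g0 G0 x)"
    unfolding affinity_def
    using assms(4,5) G0 G1
    by (intro integral_mono) (auto simp: affinity_integrand_def p intro: Youngs_inequality_0)
  also have "\<dots> = 1" using G0 G1 by simp
  finally show ?thesis .
qed

section \<open>The saddle value of the affinity\<close>

text \<open>Each minimum is expressed as an attained \<open>INF\<close>. Suprema are taken in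
  \<open>ereal\<close>, where they make sense for an empty product too.\<close>

theorem theoremB1:
  fixes M :: "'a measure"
    and \<G>0 \<G>1 :: "'a measure set"
    and g0 g1 :: "'a measure \<Rightarrow> 'a \<Rightarrow> real"
    and K :: "'v::linear_topological_space set"
    and pt :: "'v \<Rightarrow> 'a measure \<times> 'a measure"
  assumes class0: "uncertainty_class M g0 \<G>0"
    and class1: "uncertainty_class M g1 \<G>1"
    \<comment> \<open>\<open>pt\<close> identifies the subset \<open>K\<close> of the linear topological space with \<open>\<G>0 \<times> \<G>1\<close>\<close>
    and ident: "bij_betw pt K (\<G>0 \<times> \<G>1)"
    and i_real: "\<And>u p. u \<in> {0..1} \<Longrightarrow> p \<in> \<G>0 \<times> \<G>1 \<Longrightarrow>
                   integrable M (affinity_integrand g0 g1 u p)"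
    and i_usc: "\<And>u. u \<in> {0..1} \<Longrightarrow>
                   upper_semicontinuous_on K (\<lambda>v. affinity M g0 g1 u (pt v))"
    and i_qconc: "\<And>u. u \<in> {0..1} \<Longrightarrow>
                   quasi_concave_on K (\<lambda>v. affinity M g0 g1 u (pt v))"
    and ii_lsc: "\<And>p. p \<in> \<G>0 \<times> \<G>1 \<Longrightarrow>
                   lower_semicontinuous_on {0..1} (\<lambda>u. affinity M g0 g1 u p)"
    and ii_qconv: "\<And>p. p \<in> \<G>0 \<times> \<G>1 \<Longrightarrow>
                   quasi_convex_on {0..1} (\<lambda>u. affinity M g0 g1 u p)"
    and iii: "compact {0..1::real}" "convex {0..1::real}"
    and iv: "convex K"
  shows "attains_min_on {0<..<1} (\<lambda>u. SUP p\<in>\<G>0 \<times> \<G>1. ereal (affinity M g0 g1 u p)) \<and>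
         (\<forall>p\<in>\<G>0 \<times> \<G>1. attains_min_on {0<..<1} (\<lambda>u. affinity M g0 g1 u p)) \<and>
         (INF u\<in>{0<..<1}. SUP p\<in>\<G>0 \<times> \<G>1. ereal (affinity M g0 g1 u p)) =
         (SUP p\<in>\<G>0 \<times> \<G>1. INF u\<in>{0<..<1}. ereal (affinity M g0 g1 u p))"
proof (intro conjI ballI)
  let ?P = "\<G>0 \<times> \<G>1"
  let ?D = "affinity M g0 g1"
  let ?F = "\<lambda>u. SUP p\<in>?P. ereal (?D u p)"
  note D0 = affinity_0[OF class0 class1] and D1 = affinity_1[OF class0 class1]
  have D_le: "?D u p \<le> 1" if "p \<in> ?P" "u \<in> {0..1}" for u p
    using affinity_le_1[OF class0 class1 that i_real[OF that(2,1)]] .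
  \<comment> \<open>At both endpoints every affinity equals 1, its largest possible value.\<close>
  have F_le: "?F u \<le> ?F e" if "u \<in> {0<..<1}" "e \<in> {0, 1}" for u e
    using that D_le D0 D1 by (intro SUP_mono) force
  have "attains_min_on {0..1} ?F"
    by (rule lsc_attains_min_on; (rule lower_semicontinuous_on_SUP[OF ii_lsc])?) auto
  then show "attains_min_on {0<..<1} ?F"
    using F_le by (intro attains_min_on_interior) auto
  show "attains_min_on {0<..<1} (\<lambda>u. ?D u p)" if p: "p \<in> ?P" for p
  proof (rule attains_min_on_interior)
    show "attains_min_on {0..1} (\<lambda>u. ?D u p)"
      using ii_lsc[OF p] unfolding lower_semicontinuous_on_def
      by (intro lsc_attains_min_on) auto
  qed (use p D_le D0 D1 in auto)
  show "(INF u\<in>{0<..<1}. ?F u) = (SUP p\<in>?P. INF u\<in>{0<..<1}. ereal (?D u p))"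
    (is "?L = ?R")
  proof (rule antisym)
    show "?R \<le> ?L"
      by (intro SUP_least INF_greatest) (meson INF_lower SUP_upper order_trans)
    show "?L \<le> ?R"
    proof (rule ccontr)
      assume "\<not> ?L \<le> ?R"
      then obtain c where c: "?R < ereal c" "ereal c < ?L"
        using ereal_dense2[of ?R ?L] by (auto simp: not_le)
      have lt: "\<exists>u\<in>{0..1}. ?D u p < c" if "p \<in> ?P" for p
      proof -
        have "(INF u\<in>{0<..<1}. ereal (?D u p)) < ereal c"
          using SUP_upper[OF that] c(1) by (rule le_less_trans)
        then obtain u where "u \<in> {0<..<1}" "?D u p < c" by (auto simp: INF_less_iff)
        then show ?thesis by (auto intro!: bexI[of _ u])
      qed
      have half: "ereal c < ?F u" if "u \<in> {0<..<1}" for u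
        using c(2) INF_lower[OF that] by (rule less_le_trans)
      \<comment> \<open>A supremum over the empty set would be minus infinity, which is not above
        \<open>c\<close>; the point \<open>1/2\<close> is an arbitrary interior one.\<close>
      from half[of "1/2"] have "?P \<noteq> {}" by (auto simp: bot_ereal_def)
      then have "K \<noteq> {}" using ident by (auto simp: bij_betw_def)
      have ptP: "pt v \<in> ?P" if "v \<in> K" for v using ident that by (auto simp: bij_betw_def)
      have "\<exists>u\<in>{0..1}. \<forall>v\<in>K. ?D u (pt v) \<le> c"
        using i_usc i_qconc iv \<open>K \<noteq> {}\<close> ii_lsc ii_qconv lt ptP by (intro minimax_level) blast+
      then obtain u where u: "u \<in> {0..1}" "\<And>p. p \<in> ?P \<Longrightarrow> ?D u p \<le> c"
        unfolding bij_betw_imp_surj_on[OF ident, symmetric] by blast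
      \<comment> \<open>The minimax argument runs on the compact interval and may return an
        endpoint. Then \<open>1 \<le> c\<close>, and any interior point serves, as affinities never
        exceed 1.\<close>
      have "\<exists>s\<in>{0<..<1}. \<forall>p\<in>?P. ?D s p \<le> c"
      proof (cases "u \<in> {0<..<1}")
        case True
        then show ?thesis using u(2) by blast
      next
        case False
        then have "u = 0 \<or> u = 1" using u(1) by auto
        then have "1 \<le> c" using u(2) D0 D1 \<open>?P \<noteq> {}\<close> by fastforce
        then have "\<forall>p\<in>?P. ?D (1/2) p \<le> c"
          by (intro ballI order_trans[OF D_le]) auto
        then show ?thesis by (intro bexI[of _ "1/2"]) auto
      qed
      then obtain s where s: "s \<in> {0<..<1}" "\<And>p. p \<in> ?P \<Longrightarrow> ?D s p \<le> c" by blast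
      then have "?F s \<le> ereal c" by (intro SUP_least) auto
      with half[OF s(1)] show False by simp
    qed
  qed
qed

end
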